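(* Let $\mathbb{F}$ be a field of characteristic $0$. There is no family $(C_n)_{n \in \mathbb{N}}$ of arithmetic circuits over $\mathbb{F}$ such that, for every $n$, $C_n$ is $\mathrm{Alt}_n \times \mathrm{Alt}_n$-symmetric and computes the determinant $\det\big((x_{ij})_{i,j\in[n]}\big)$ of the $n\times n$ matrix of variables, and such that the size of $C_n$ is $2^{o(n)}$.
   Context: An arithmetic circuit over $\mathbb{F}$ for $n\times n$ matrices is a directed acyclic graph whose input gates are labelled by variables $x_{ij}$ ($i,j\in[n]$, $[n]=\{1,\dots,n\}$) or by constants from $\mathbb{F}$, whose internal gates are labelled by addition or multiplication, and which has a designated output gate; it computes a polynomial in the $x_{ij}$ in the usual way. Its size is its number of gates. The group $\mathrm{Sym}_n\times\mathrm{Sym}_n$ acts on the variables by $(\sigma,\pi)\cdot x_{ij}=x_{\sigma(i)\pi(j)}$. For a subgroup $G\le \mathrm{Sym}_n\times\mathrm{Sym}_n$, a circuit $C$ is $G$-symmetric if for every $g\in G$ the action of $g$ on the variable labels of the input gates extends to an automorphism of $C$ (a bijection on gates preserving wires, gate labels, constant labels and the output gate, and mapping an input gate labelled $x_{ij}$ to the input gate labelled $g\cdot x_{ij}$). $\mathrm{Alt}_n$ is the alternating group on $[n]$. *)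

theory Defs
  imports Complex_Main "HOL-Library.Poly_Mapping" "HOL-Library.Landau_Symbols"
    "HOL-Combinatorics.Permutations"
begin

text \<open>Formal polynomials over 'a in the variables x_ij, indexed by pairs (i,j):
  a polynomial is a finitely supported map from monomials (finitely supported
  exponent vectors on nat \<times> nat) to coefficients.\<close>
type_synonym 'a mpoly = "((nat \<times> nat) \<Rightarrow>\<^sub>0 nat) \<Rightarrow>\<^sub>0 'a"

definition pvar :: "nat \<Rightarrow> nat \<Rightarrow> 'a::comm_semiring_1 mpoly" where
  "pvar i j = Poly_Mapping.single (Poly_Mapping.single (i, j) 1) 1"

definition pconst :: "'a::comm_semiring_1 \<Rightarrow> 'a mpoly" where
  "pconst c = Poly_Mapping.single 0 c"

definition det_poly :: "nat \<Rightarrow> 'a::comm_ring_1 mpoly" where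
  "det_poly n = (\<Sum>p | p permutes {1..n}.
      pconst (of_int (sign p)) * (\<Prod>i\<in>{1..n}. pvar i (p i)))"

datatype 'a gate_label = Var nat nat | Const 'a | Plus | Times

text \<open>An arithmetic circuit: gates are natural numbers from a finite set,
  wires are pairs (h, g) meaning gate h feeds into gate g, each gate carries a label,
  and there is a designated out_gate gate.\<close>
record 'a circuit =
  gates :: "nat set"
  wires :: "(nat \<times> nat) set"
  label :: "nat \<Rightarrow> 'a gate_label"
  out_gate :: nat

definition children :: "'a circuit \<Rightarrow> nat \<Rightarrow> nat set" where
  "children C g = {h. (h, g) \<in> wires C}"

definition wf_circuit :: "nat \<Rightarrow> 'a circuit \<Rightarrow> bool" where
  "wf_circuit n C \<longleftrightarrow>
     finite (gates C) \<and> out_gate C \<in> gates C \<and>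
     wires C \<subseteq> gates C \<times> gates C \<and>
     wf (wires C) \<and>
     (\<forall>g\<in>gates C. \<forall>i j. label C g = Var i j \<longrightarrow> i \<in> {1..n} \<and> j \<in> {1..n}) \<and>
     (\<forall>g\<in>gates C. (\<exists>i j. label C g = Var i j) \<or> (\<exists>c. label C g = Const c)
                     \<longrightarrow> children C g = {})"

definition circuit_valuation :: "'a::comm_ring_1 circuit \<Rightarrow> (nat \<Rightarrow> 'a mpoly) \<Rightarrow> bool" where
  "circuit_valuation C v \<longleftrightarrow>
     (\<forall>g\<in>gates C. v g = (case label C g of
         Var i j \<Rightarrow> pvar i j
       | Const c \<Rightarrow> pconst c
       | Plus \<Rightarrow> (\<Sum>h\<in>children C g. v h)
       | Times \<Rightarrow> (\<Prod>h\<in>children C g. v h)))"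

text \<open>Since a well-formed circuit is acyclic, the valuation is uniquely determined.\<close>
definition computes :: "'a::comm_ring_1 circuit \<Rightarrow> 'a mpoly \<Rightarrow> bool" where
  "computes C p \<longleftrightarrow> (\<exists>v. circuit_valuation C v \<and> v (out_gate C) = p)"

definition circuit_size :: "'a circuit \<Rightarrow> nat" where
  "circuit_size C = card (gates C)"

fun act_label :: "(nat \<Rightarrow> nat) \<times> (nat \<Rightarrow> nat) \<Rightarrow> 'a gate_label \<Rightarrow> 'a gate_label" where
  "act_label (\<sigma>, \<pi>) (Var i j) = Var (\<sigma> i) (\<pi> j)"
| "act_label _ (Const c) = Const c"
| "act_label _ Plus = Plus"
| "act_label _ Times = Times"

definition symmetric_circuit ::
    "((nat \<Rightarrow> nat) \<times> (nat \<Rightarrow> nat)) set \<Rightarrow> 'a circuit \<Rightarrow> bool" where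
  "symmetric_circuit G C \<longleftrightarrow>
     (\<forall>g\<in>G. \<exists>f. bij_betw f (gates C) (gates C) \<and>
        (\<forall>a\<in>gates C. \<forall>b\<in>gates C. (a, b) \<in> wires C \<longleftrightarrow> (f a, f b) \<in> wires C) \<and>
        (\<forall>a\<in>gates C. label C (f a) = act_label g (label C a)) \<and>
        f (out_gate C) = out_gate C)"

definition alt_group :: "nat \<Rightarrow> (nat \<Rightarrow> nat) set" where
  "alt_group n = {\<sigma>. \<sigma> permutes {1..n} \<and> evenperm \<sigma>}"

definition alt_alt :: "nat \<Rightarrow> ((nat \<Rightarrow> nat) \<times> (nat \<Rightarrow> nat)) set" where
  "alt_alt n = alt_group n \<times> alt_group n"

end

theory Submission
  imports Defs
begin

text \<open>
  Only the even row permutations are needed. The permutations that extend to an automorphism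
  fixing a given gate form a subgroup of \<open>Alt\<^sub>n\<close> whose index is at most the size of the circuit.
  If this is \<open>2\<^bsup>o(n)\<^esup>\<close>, then the subgroup contains the alternating group on a set \<open>U\<close> of more than
  half of the rows: a set of rows without a 3-cycle of the subgroup is small by Bochert's
  commutator argument, so the rows fall into few classes on which the subgroup is alternating,
  and all but a few rows lie in one class because otherwise swapping pairs of rows from different
  classes would produce too many cosets.

  By induction over the gates, the polynomial of a gate is invariant under all transpositions
  within its set \<open>U\<close>: an odd permutation can be corrected, for each child separately, by a
  transposition that fixes the child, and thereby acts like an even one. Hence the
  output is invariant under some odd row permutation, whereas the determinant changes sign.
\<close>

section \<open>Subgroups of small index\<close>

text \<open>As \<open>a\<close> is the only point moved by both, \<open>y\<close> fixes
  \<open>x a\<close> and \<open>x\<close> fixes \<open>y a\<close>. So everything cancels except the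
  cycle from \<open>a\<close> to \<open>x a\<close> to \<open>y a\<close> and back to
  \<open>a\<close>.\<close>

lemma commutator_3_cycle:
  assumes x: "x permutes S" and y: "y permutes S"
    and common: "\<And>z. x z \<noteq> z \<Longrightarrow> y z \<noteq> z \<Longrightarrow> z = a" and a: "x a \<noteq> a" "y a \<noteq> a"
  shows "x \<circ> y \<circ> inv x \<circ> inv y = transpose a (x a) \<circ> transpose (x a) (y a)"
proof
  fix z
  have ix: "inv x (x w) = w" "x (inv x w) = w" for w
    using x by (simp_all add: permutes_inverses)
  have iy: "inv y (y w) = w" "y (inv y w) = w" for w
    using y by (simp_all add: permutes_inverses)
  have xinj: "x u = x w \<longleftrightarrow> u = w" for u w using ix(1) by metis
  have yinj: "y u = y w \<longleftrightarrow> u = w" for u w using iy(1) by metis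
  have yx: "y (x a) = x a" using common[of "x a"] a xinj by metis
  have xy: "x (y a) = y a" using common[of "y a"] a yinj by metis
  have ne: "x a \<noteq> y a" using yx a yinj by metis
  consider "z = a" | "z = x a" | "z = y a" | "z \<noteq> a" "z \<noteq> x a" "z \<noteq> y a" by blast
  then show "(x \<circ> y \<circ> inv x \<circ> inv y) z = (transpose a (x a) \<circ> transpose (x a) (y a)) z"
  proof cases
    case 1
    define d where "d = inv y a"
    have d: "y d = a" using iy d_def by simp
    then have "x d = d" using common[of d] a yinj by metis
    then have "inv x d = d" using ix by metis
    then show ?thesis using 1 a ne d d_def by (simp add: transpose_def)
  next
    case 2
    have "inv y (x a) = x a" using yx iy by metis
    then show ?thesis using 2 ix xy ne a by (simp add: transpose_def)
  next
    case 3
    define e where "e = inv x a"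
    have e: "x e = a" using ix e_def by simp
    then have "y e = e" using common[of e] a xinj by metis
    then show ?thesis using 3 iy e e_def ne a by (simp add: transpose_def)
  next
    case 4
    have "x (y (inv x (inv y z))) = z"
    proof (cases "y z = z")
      case True
      then have "inv y z = z" using iy by metis
      moreover have "y (inv x z) = inv x z"
        using common[of "inv x z"] 4 ix True by metis
      ultimately show ?thesis using ix by simp
    next
      case False
      then have xz: "x z = z" using common 4 by blast
      have "x (inv y z) = inv y z"
        using common[of "inv y z"] 4 iy xz by metis
      then have "inv x (inv y z) = inv y z" using ix by metis
      then show ?thesis using iy xz by simp
    qed
    then show ?thesis using 4 by (simp add: transpose_def)
  qed
qed

text \<open>For an involution \<open>\<mu>\<close> this performs only the swaps of pairs that meet
  \<open>I\<close>. Varying \<open>I\<close> over sets of smaller partners gives exponentially many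
  permutations to distribute over few cosets.\<close>

definition partial_swap :: "('a \<Rightarrow> 'a) \<Rightarrow> 'a set \<Rightarrow> 'a \<Rightarrow> 'a" where
  "partial_swap \<mu> I x = (if x \<in> I \<union> \<mu> ` I then \<mu> x else x)"

lemma partial_swap_involution:
  assumes "\<And>x. \<mu> (\<mu> x) = x" shows "partial_swap \<mu> I (partial_swap \<mu> I x) = x"
proof -
  have "\<mu> x \<in> I \<union> \<mu> ` I \<longleftrightarrow> x \<in> I \<union> \<mu> ` I" using assms by (metis Un_iff imageE imageI)
  then show ?thesis unfolding partial_swap_def using assms by auto
qed

lemma involution_permutes:
  assumes "\<And>x. p (p x) = x" "\<And>x. x \<notin> S \<Longrightarrow> p x = x" shows "p permutes S"
  unfolding permutes_def using assms by metis

text \<open>Permutations with the same code lie in the same left coset of \<open>A\<close>, so the index of \<open>A\<close> is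
  at most the number of codes.\<close>

locale coded_subgroup =
  fixes X :: "nat set" and A :: "(nat \<Rightarrow> nat) set"
    and code :: "(nat \<Rightarrow> nat) \<Rightarrow> 'c" and Z :: "'c set"
  assumes finite_X: "finite X"
    and A_permutes: "g \<in> A \<Longrightarrow> g permutes X"
    and A_comp: "g \<in> A \<Longrightarrow> h \<in> A \<Longrightarrow> g \<circ> h \<in> A"
    and A_inv: "g \<in> A \<Longrightarrow> inv g \<in> A"
    and finite_Z: "finite Z"
    and code_in: "g permutes X \<Longrightarrow> code g \<in> Z"
    and code_eq: "g permutes X \<Longrightarrow> h permutes X \<Longrightarrow> code g = code h \<Longrightarrow> inv g \<circ> h \<in> A"
begin

section \<open>3-cycles in the subgroup and the linkage relation\<close>

definition tri :: "nat \<Rightarrow> nat \<Rightarrow> nat \<Rightarrow> bool" where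
  "tri a b c \<longleftrightarrow> a \<noteq> b \<and> b \<noteq> c \<and> a \<noteq> c \<and> transpose a b \<circ> transpose b c \<in> A"

text \<open>This turns out to be an equivalence relation such that \<open>A\<close> contains every
  3-cycle within a class. Equality is included for the points that lie on no 3-cycle of
  \<open>A\<close>.\<close>

definition linked :: "nat \<Rightarrow> nat \<Rightarrow> bool" where
  "linked a b \<longleftrightarrow> a = b \<or> (\<exists>z. tri a b z)"

lemma id_in_A: "id \<in> A"
  using code_eq[of id id] permutes_id by simp

lemma A_bij: "g \<in> A \<Longrightarrow> bij g"
  using A_permutes permutes_bij by blast

lemma tri_rot: "tri a b c \<Longrightarrow> tri b c a"
proof -
  assume t: "tri a b c"
  then have "transpose a b \<circ> transpose b c = transpose b c \<circ> transpose c a"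
    unfolding tri_def by (auto simp: fun_eq_iff transpose_def)
  with t show ?thesis unfolding tri_def by auto
qed

lemma tri_flip: "tri a b c \<Longrightarrow> tri b a c"
proof -
  assume t: "tri a b c"
  then have "inv (transpose a b \<circ> transpose b c) = transpose b a \<circ> transpose a c"
    unfolding tri_def
    by (subst o_inv_distrib) (auto simp: fun_eq_iff transpose_def)
  with t show ?thesis unfolding tri_def using A_inv by (metis (no_types))
qed

lemma tri_conj:
  assumes "tri a b c" "g \<in> A" shows "tri (g a) (g b) (g c)"
proof -
  have b: "bij g" using A_bij assms by blast
  have "transpose (g a) (g b) \<circ> transpose (g b) (g c) \<circ> g
      = g \<circ> (transpose a b \<circ> transpose b c)"
    using b by (auto simp: fun_eq_iff transpose_def bij_is_inj inj_eq)
  then have "transpose (g a) (g b) \<circ> transpose (g b) (g c) \<circ> (g \<circ> inv g)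
      = g \<circ> (transpose a b \<circ> transpose b c) \<circ> inv g"
    by (metis comp_assoc)
  moreover have "g \<circ> inv g = id" using b bij_is_surj surj_iff by blast
  ultimately have "transpose (g a) (g b) \<circ> transpose (g b) (g c)
      = g \<circ> (transpose a b \<circ> transpose b c) \<circ> inv g" by simp
  moreover have "\<dots> \<in> A" using assms A_comp A_inv unfolding tri_def by blast
  ultimately show ?thesis using assms(1) b unfolding tri_def
    by (auto simp: bij_is_inj inj_eq)
qed

text \<open>Conjugation by the cycle on \<open>a\<close>, \<open>b\<close>, \<open>c\<close> carries
  \<open>a\<close>, \<open>b\<close>, \<open>d\<close> to \<open>b\<close>, \<open>c\<close>,
  \<open>d\<close>.\<close>

lemma tri_two_common:
  assumes "tri a b c" "tri a b d" "c \<noteq> d" shows "tri b c d"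
proof -
  have "tri ((transpose a b \<circ> transpose b c) a) ((transpose a b \<circ> transpose b c) b)
          ((transpose a b \<circ> transpose b c) d)"
    using assms tri_conj tri_def by blast
  moreover have "(transpose a b \<circ> transpose b c) a = b" "(transpose a b \<circ> transpose b c) b = c"
    "(transpose a b \<circ> transpose b c) d = d"
    using assms unfolding tri_def by (simp_all add: transpose_def)
  ultimately show ?thesis by simp
qed

text \<open>Conjugation by the cycle on \<open>a\<close>, \<open>d\<close>, \<open>e\<close> turns
  \<open>a\<close>, \<open>b\<close>, \<open>c\<close> into \<open>d\<close>, \<open>b\<close>,
  \<open>c\<close>. The new cycle shares two points with the old one, which reduces to
  \<open>tri_two_common\<close>.\<close>

lemma tri_one_common:
  assumes "tri a b c" "tri a d e" "distinct [a, b, c, d, e]" shows "tri c a d"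
proof -
  have "tri ((transpose a d \<circ> transpose d e) a) ((transpose a d \<circ> transpose d e) b)
          ((transpose a d \<circ> transpose d e) c)"
    using assms tri_conj tri_def by blast
  then have "tri d b c" using assms(3) by (simp add: transpose_def split: if_splits)
  then show ?thesis
    using tri_two_common[of b c a d] tri_rot assms by auto
qed

lemma linked_sym: "linked a b \<Longrightarrow> linked b a"
  unfolding linked_def using tri_flip by blast

text \<open>The two 3-cycles witnessing the links meet in \<open>b\<close>. Either one of them
  already is the wanted cycle, or they share exactly one or two points and are combined by
  conjugation.\<close>

lemma linked_tri:
  assumes "linked a b" "linked b c" "distinct [a, b, c]" shows "tri a b c"
proof -
  obtain k m where k: "tri a b k" and m: "tri b c m"
    using assms unfolding linked_def by auto
  have d: "a \<noteq> b" "b \<noteq> k" "a \<noteq> k" "b \<noteq> c" "c \<noteq> m" "b \<noteq> m" "a \<noteq> c"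
    using k m assms(3) unfolding tri_def by auto
  consider "k = c" | "m = a" | "k = m" | "k \<noteq> c" "m \<noteq> a" "k \<noteq> m" by blast
  then show ?thesis
  proof cases
    case 1 then show ?thesis using k by simp
  next
    case 2 then show ?thesis using m tri_rot by blast
  next
    case 3
    have "tri k b a" "tri k b c" using k m 3 tri_rot tri_flip by blast+
    then have "tri b a c" using tri_two_common d by blast
    then show ?thesis by (rule tri_flip)
  next
    case 4
    have "tri b k a" using k tri_rot by blast
    then show ?thesis using tri_one_common[of b k a c m] m d 4 by auto
  qed
qed

lemma linked_trans: "linked a b \<Longrightarrow> linked b c \<Longrightarrow> linked a c"
  using linked_tri[of a b c] tri_rot tri_flip unfolding linked_def
  by (metis distinct_length_2_or_more distinct_singleton)

lemma linked_image:
  assumes "g \<in> A" shows "linked (g a) (g b) \<longleftrightarrow> linked a b"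
proof
  assume "linked a b" then show "linked (g a) (g b)"
    unfolding linked_def using tri_conj assms by blast
next
  assume "linked (g a) (g b)"
  then have "linked (inv g (g a)) (inv g (g b))"
    unfolding linked_def by (metis tri_conj[OF _ A_inv[OF assms]])
  then show "linked a b" using A_bij[OF assms] by (simp add: bij_is_inj)
qed

text \<open>Elements of \<open>A\<close> permute the linkage classes, so whether a point stays in
  its class depends only on the class.\<close>

lemma linked_moved_iff:
  assumes "g \<in> A" "linked a b" shows "linked (g a) a \<longleftrightarrow> linked (g b) b"
  using assms linked_image linked_trans linked_sym by meson

section \<open>Consequences of a small index\<close>

lemma fact_le_card_code:
  assumes "W \<subseteq> X" and triv: "\<And>g. g \<in> A \<Longrightarrow> g permutes W \<Longrightarrow> g = id"
  shows "fact (card W) \<le> card Z"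
proof -
  have fW: "finite W" using assms finite_X finite_subset by blast
  \<comment> \<open>Two permutations of \<open>W\<close> with equal code have their quotient in
    \<open>A\<close>, and this quotient is again a permutation of \<open>W\<close>, hence
    trivial.\<close>
  have inj: "inj_on code {p. p permutes W}"
  proof (rule inj_onI, clarify)
    fix p q assume pq: "p permutes W" "q permutes W" "code p = code q"
    have "inv p \<circ> q \<in> A"
      using code_eq pq assms(1) permutes_subset by blast
    then have "inv p \<circ> q = id" using triv pq permutes_inv permutes_compose by blast
    then have "p \<circ> (inv p \<circ> q) = p" by simp
    then show "p = q" using pq(1) by (simp add: o_assoc permutes_inv_o)
  qed
  have "card {p. p permutes W} = fact (card W)"
    using fW by (simp add: card_permutations)
  moreover have "card {p. p permutes W} \<le> card Z"
    by (rule card_inj_on_le[OF inj _ finite_Z]) (use code_in assms(1) permutes_subset in blast)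
  ultimately show ?thesis by simp
qed

text \<open>Bochert's argument: if a minimal base of the subgroup on \<open>U\<close> has more than half of the
  points, then there are two elements with exactly one common moved point, and their
  commutator is a 3-cycle.\<close>

lemma tri_free_fact_le:
  assumes U: "U \<subseteq> X" and free: "\<And>a b c. a \<in> U \<Longrightarrow> b \<in> U \<Longrightarrow> c \<in> U \<Longrightarrow> \<not> tri a b c"
  shows "\<exists>w. card U \<le> 2 * w \<and> fact w \<le> card Z"
proof -
  have fU: "finite U" using U finite_X finite_subset by blast
  define base where "base S \<longleftrightarrow> S \<subseteq> U \<and>
    (\<forall>g\<in>A. g permutes U \<longrightarrow> (\<forall>z\<in>S. g z = z) \<longrightarrow> g = id)" for S
  have "base U" unfolding base_def by (auto simp: permutes_def fun_eq_iff)
  then obtain S where S: "base S" and minimal: "\<And>S'. base S' \<Longrightarrow> card S \<le> card S'"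
    using ex_has_least_nat[of base U card] by blast
  have SU: "S \<subseteq> U" using S base_def by blast
  have fS: "finite S" using SU fU finite_subset by blast
  have "card S \<le> card (U - S)"
  proof (rule ccontr)
    assume "\<not> card S \<le> card (U - S)"
    then have "\<not> base (U - S)" using minimal by blast
    \<comment> \<open>Minimality is used twice: \<open>U - S\<close> is no base, which gives
      \<open>x\<close> supported on \<open>S\<close>; and \<open>S - {a}\<close> is no base, which
      gives \<open>y\<close> moving no point of \<open>S\<close> other than
      \<open>a\<close>.\<close>
    then obtain x where x: "x \<in> A" "x permutes U" "\<forall>z\<in>U - S. x z = z" "x \<noteq> id"
      unfolding base_def by blast
    then obtain a where a: "x a \<noteq> a" by (auto simp: fun_eq_iff)
    then have aS: "a \<in> S" using x by (metis DiffI permutes_not_in)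
    then have "card (S - {a}) < card S" using fS by (intro card_Diff1_less)
    then have "\<not> base (S - {a})" using minimal leD by blast
    then obtain y where y: "y \<in> A" "y permutes U" "\<forall>z\<in>S - {a}. y z = z" "y \<noteq> id"
      unfolding base_def using SU by blast
    have ya: "y a \<noteq> a" using y S unfolding base_def by (metis Diff_iff singletonD)
    have common: "z = a" if "x z \<noteq> z" "y z \<noteq> z" for z
      using that x y by (metis Diff_iff permutes_not_in singletonD)
    have "x \<circ> y \<circ> inv x \<circ> inv y = transpose a (x a) \<circ> transpose (x a) (y a)"
      using common a ya by (intro commutator_3_cycle[OF x(2) y(2)])
    moreover have "x \<circ> y \<circ> inv x \<circ> inv y \<in> A" by (intro A_comp A_inv x y)
    moreover have "x a \<noteq> y a"
    proof
      assume eq: "x a = y a"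
      have "x (x a) \<noteq> x a" using a permutes_inj[OF x(2)] by (simp add: inj_eq)
      moreover have "y (x a) \<noteq> x a" using ya permutes_inj[OF y(2)] eq by (simp add: inj_eq)
      ultimately show False using common a by blast
    qed
    ultimately have "tri a (x a) (y a)" using a ya unfolding tri_def by auto
    moreover have "a \<in> U" "x a \<in> U" "y a \<in> U"
      using aS SU x y by (auto simp: permutes_in_image)
    ultimately show False using free by blast
  qed
  moreover have "card U = card S + card (U - S)"
    using SU fU by (metis card_Diff_subset card_mono finite_subset le_add_diff_inverse)
  \<comment> \<open>Elements supported off the base fix it pointwise and are therefore
    trivial.\<close>
  moreover have "fact (card (U - S)) \<le> card Z"
  proof (rule fact_le_card_code)
    show "U - S \<subseteq> X" using U by blast
    fix g assume g: "g \<in> A" "g permutes U - S"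
    then have "g permutes U" using permutes_subset by blast
    moreover have "\<forall>z\<in>S. g z = z" using g by (simp add: permutes_not_in)
    ultimately show "g = id" using g S unfolding base_def by blast
  qed
  ultimately show ?thesis by (intro exI[of _ "card (U - S)"]) simp
qed

text \<open>A crude estimate of the factorial by a power of two; a bound linear in \<open>k\<close>
  is all that is wanted.\<close>

lemma tri_free_card_le:
  assumes "U \<subseteq> X" "\<And>a b c. a \<in> U \<Longrightarrow> b \<in> U \<Longrightarrow> c \<in> U \<Longrightarrow> \<not> tri a b c"
    and Zk: "card Z \<le> 2 ^ k"
  shows "card U \<le> 2 * k + 2"
proof -
  obtain w where w: "card U \<le> 2 * w" "fact w \<le> card Z"
    using tri_free_fact_le[OF assms(1,2)] by blast
  have pow: "2 ^ v \<le> (fact (Suc v) :: nat)" for v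
    by (induction v) (auto simp: mult_le_mono)
  have "w \<le> k + 1"
  proof (cases w)
    case (Suc v)
    then have "(2::nat) ^ v \<le> 2 ^ k" using pow[of v] w(2) Zk by (metis order_trans)
    then show ?thesis using Suc by simp
  qed simp
  then show ?thesis using w by simp
qed

text \<open>All partial swaps of pairs of unlinked points that have the same code differ by elements
  of \<open>A\<close>; such an element is determined by the linkage classes that it moves.\<close>

lemma unlinked_matching_card_le:
  assumes mu: "\<mu> permutes X" "\<And>x. \<mu> (\<mu> x) = x" "\<And>x. \<mu> x \<noteq> x \<Longrightarrow> \<not> linked (\<mu> x) x"
    and Zk: "card Z \<le> 2 ^ k"
  shows "card {x. x < \<mu> x} \<le> 3 * k + 2"
proof -
  define P where "P = {x. x < \<mu> x}"
  have PX: "P \<subseteq> X" unfolding P_def using mu(1) by (auto simp: permutes_def)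
  have fP: "finite P" using PX finite_X finite_subset by blast
  \<comment> \<open>The least point of a linkage class serves as its representative.\<close>
  define rep where "rep x = (LEAST y. linked y x)" for x
  have rep: "linked (rep x) x" for x
    unfolding rep_def by (rule LeastI[of _ x]) (simp add: linked_def)
  have rep_eq: "rep x = rep y" if "linked x y" for x y
  proof -
    have "linked z x \<longleftrightarrow> linked z y" for z using that linked_trans linked_sym by blast
    then show ?thesis unfolding rep_def by simp
  qed
  define R where "R = rep ` P"
  have fR: "finite R" using fP R_def by simp
  have RX: "R \<subseteq> X"
  proof
    fix r assume "r \<in> R"
    then obtain x where x: "x \<in> P" "r = rep x" using R_def by blast
    have l: "linked r x" using rep x by simp
    show "r \<in> X"
    proof (cases "r = x")
      case True then show ?thesis using x PX by blast
    next
      case False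
      then obtain z where z: "tri r x z" using l linked_def by blast
      then have "(transpose r x \<circ> transpose x z) r \<noteq> r"
        unfolding tri_def by (auto simp: transpose_def)
      moreover have "transpose r x \<circ> transpose x z permutes X"
        using z A_permutes unfolding tri_def by blast
      ultimately show ?thesis by (metis permutes_not_in)
    qed
  qed
  \<comment> \<open>Distinct representatives are not linked, so no 3-cycle of \<open>A\<close> lies
    within \<open>R\<close>.\<close>
  have "card R \<le> 2 * k + 2"
  proof (rule tri_free_card_le[OF RX _ Zk])
    fix a b c assume "a \<in> R" "b \<in> R"
    then obtain x y where xy: "a = rep x" "b = rep y" using R_def by blast
    show "\<not> tri a b c"
    proof
      assume t: "tri a b c"
      then have "linked a b" unfolding linked_def by blast
      then have "rep a = rep b" using rep_eq by blast
      moreover have "rep a = a" "rep b = b" using rep_eq[OF rep] xy by simp_all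
      ultimately show False using t unfolding tri_def by simp
    qed
  qed
  define s where "s = partial_swap \<mu>"
  have s_inv: "s I (s I x) = x" for I x unfolding s_def by (rule partial_swap_involution) (rule mu(2))
  have s_perm: "s I permutes X" if "I \<subseteq> P" for I
  proof (rule involution_permutes)
    show "s I (s I x) = x" for x by (rule s_inv)
    show "s I x = x" if "x \<notin> X" for x
      using that mu(1) unfolding s_def partial_swap_def by (simp add: permutes_not_in)
  qed
  have s_P: "s I p = (if p \<in> I then \<mu> p else p)" if "I \<subseteq> P" "p \<in> P" for I p
  proof -
    have "p \<notin> \<mu> ` I" using that mu(2) unfolding P_def by fastforce
    then show ?thesis unfolding s_def partial_swap_def by simp
  qed
  have s_mu: "s I (\<mu> p) = (if p \<in> I then p else \<mu> p)" if "I \<subseteq> P" "p \<in> P" for I p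
    using s_P[OF that] s_inv[of I p] s_inv[of I "\<mu> p"] mu(2) that
    unfolding s_def partial_swap_def by (smt (verit) Un_iff imageE)
  have fibre: "card {I \<in> Pow P. code (s I) = y} \<le> 2 ^ card R" for y
  proof (cases "{I \<in> Pow P. code (s I) = y} = {}")
    case False
    then obtain J where J: "J \<subseteq> P" "code (s J) = y" by blast
    define D where "D I = {r \<in> R. \<not> linked ((s J \<circ> s I) r) r}" for I
    have inv_s: "inv (s J) = s J" using s_inv by (intro inv_equality)
    have inA: "s J \<circ> s I \<in> A" if "I \<subseteq> P" "code (s I) = y" for I
      using code_eq[OF s_perm[OF J(1)] s_perm[OF that(1)]] J that inv_s by simp
    \<comment> \<open>The quotient \<open>s J \<circ> s I\<close> maps \<open>p\<close> to the
      unlinked point \<open>\<mu> p\<close> exactly when \<open>p\<close> lies in just one of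
      \<open>I\<close> and \<open>J\<close>. So \<open>J\<close> and the set \<open>D I\<close> of
      moved classes determine \<open>I\<close>.\<close>
    have char: "p \<in> I \<longleftrightarrow> (p \<in> J \<longleftrightarrow> rep p \<notin> D I)"
      if I: "I \<subseteq> P" "code (s I) = y" and p: "p \<in> P" for I p
    proof -
      have "rep p \<in> D I \<longleftrightarrow> \<not> linked ((s J \<circ> s I) p) p"
        unfolding D_def using linked_moved_iff[OF inA[OF I] rep[of p]] p R_def by auto
      moreover have "\<not> linked (\<mu> p) p" using mu(3) p unfolding P_def by simp
      moreover have "linked p p" unfolding linked_def by simp
      ultimately show ?thesis
        using s_P[OF I(1) p] s_P[OF J(1) p] s_mu[OF J(1) p] by (cases "p \<in> I"; cases "p \<in> J") auto
    qed
    have "inj_on D {I \<in> Pow P. code (s I) = y}"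
    proof (rule inj_onI, clarify)
      fix I I' assume I: "I \<subseteq> P" "I' \<subseteq> P" "code (s I') = code (s I)" "y = code (s I)" "D I = D I'"
      show "I = I'" using char[of I] char[of I'] I by blast
    qed
    moreover have "D ` {I \<in> Pow P. code (s I) = y} \<subseteq> Pow R" unfolding D_def by blast
    ultimately show ?thesis
      using card_inj_on_le[of D _ "Pow R"] fR by (simp add: card_Pow)
  next
    case True
    show ?thesis unfolding True by simp
  qed
  \<comment> \<open>Double counting: every subset of \<open>P\<close> has one of
    \<open>card Z\<close> codes, and each code is shared by at most \<open>2 ^ card R\<close>
    subsets.\<close>
  have "2 ^ card P = card (Pow P)" using fP by (simp add: card_Pow)
  also have "\<dots> \<le> card (\<Union>y\<in>Z. {I \<in> Pow P. code (s I) = y})"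
    by (rule card_mono) (use finite_Z fP code_in s_perm in auto)
  also have "\<dots> \<le> (\<Sum>y\<in>Z. card {I \<in> Pow P. code (s I) = y})"
    by (rule card_UN_le[OF finite_Z])
  also have "\<dots> \<le> card Z * 2 ^ card R"
    using sum_bounded_above[of Z "\<lambda>y. card {I \<in> Pow P. code (s I) = y}"] fibre by simp
  also have "\<dots> \<le> 2 ^ k * 2 ^ (2 * k + 2)"
    using Zk \<open>card R \<le> 2 * k + 2\<close> by (intro mult_le_mono power_increasing) auto
  also have "\<dots> = 2 ^ (3 * k + 2)" by (simp flip: power_add)
  finally have "card P \<le> 3 * k + 2" by (rule power_le_imp_le_exp[rotated]) simp
  then show ?thesis using P_def by simp
qed

text \<open>Pair up unlinked points as far as possible. The unpaired points form \<open>U\<close>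
  and are mutually linked; the paired ones number at most twice \<open>3 * k + 2\<close>.\<close>

lemma large_alternating_part:
  assumes Zk: "card Z \<le> 2 ^ k"
  shows "\<exists>U\<subseteq>X. card X \<le> card U + 6 * k + 4 \<and>
    (\<forall>a\<in>U. \<forall>b\<in>U. \<forall>c\<in>U. \<forall>d\<in>U. a \<noteq> b \<longrightarrow> c \<noteq> d \<longrightarrow> transpose a b \<circ> transpose c d \<in> A)"
proof -
  define ok where "ok \<mu> \<longleftrightarrow> \<mu> permutes X \<and> (\<forall>x. \<mu> (\<mu> x) = x) \<and>
    (\<forall>x. \<mu> x \<noteq> x \<longrightarrow> \<not> linked (\<mu> x) x)" for \<mu>
  have "ok id" unfolding ok_def by (simp add: permutes_id)
  moreover have "\<forall>\<mu>. ok \<mu> \<longrightarrow> card {x \<in> X. \<mu> x \<noteq> x} < Suc (card X)"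
    using finite_X by (auto intro!: card_mono simp: less_Suc_eq_le)
  ultimately obtain \<mu> where \<mu>: "ok \<mu>"
    and maxi: "\<And>\<nu>. ok \<nu> \<Longrightarrow> card {x \<in> X. \<nu> x \<noteq> x} \<le> card {x \<in> X. \<mu> x \<noteq> x}"
    using ex_has_greatest_nat[of ok id "\<lambda>\<mu>. card {x \<in> X. \<mu> x \<noteq> x}" "Suc (card X)"] by blast
  have mu: "\<mu> permutes X" "\<And>x. \<mu> (\<mu> x) = x" "\<And>x. \<mu> x \<noteq> x \<Longrightarrow> \<not> linked (\<mu> x) x"
    using \<mu> ok_def by auto
  define P where "P = {x. x < \<mu> x}"
  define U where "U = {x \<in> X. \<mu> x = x}"
  have PX: "P \<subseteq> X" unfolding P_def using mu(1) by (auto simp: permutes_def)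
  have fP: "finite P" using PX finite_X finite_subset by blast
  have linkU: "linked x y" if "x \<in> U" "y \<in> U" for x y
  proof (rule ccontr)
    assume nl: "\<not> linked x y"
    then have ne: "x \<noteq> y" unfolding linked_def by auto
    have nl': "\<not> linked y x" using nl linked_sym by blast
    have fxd: "\<mu> x = x" "\<mu> y = y" "x \<in> X" "y \<in> X" using that U_def by auto
    \<comment> \<open>Adding the pair of \<open>x\<close> and \<open>y\<close> to the matching would
      contradict its maximality.\<close>
    define \<nu> where "\<nu> = \<mu>(x := y, y := x)"
    have off: "\<mu> z \<noteq> x" "\<mu> z \<noteq> y" if "z \<noteq> x" "z \<noteq> y" for z using mu(2) fxd that by metis+
    have "ok \<nu>" unfolding ok_def
    proof (intro conjI allI impI)
      show inv: "\<nu> (\<nu> z) = z" for z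
        using off[of z] mu(2)[of z] ne by (cases "z = x"; cases "z = y") (simp_all add: \<nu>_def)
      show "\<nu> permutes X"
        by (rule involution_permutes[OF inv])
          (use fxd(3,4) permutes_not_in[OF mu(1)] in \<open>simp add: \<nu>_def, blast\<close>)
      show "\<not> linked (\<nu> z) z" if "\<nu> z \<noteq> z" for z
        using that mu(3)[of z] nl nl' by (cases "z = x"; cases "z = y") (simp_all add: \<nu>_def)
    qed
    then have "card {x \<in> X. \<nu> x \<noteq> x} \<le> card {x \<in> X. \<mu> x \<noteq> x}" by (rule maxi)
    moreover have "card {x \<in> X. \<mu> x \<noteq> x} < card {x \<in> X. \<nu> x \<noteq> x}"
    proof (rule psubset_card_mono)
      have "x \<in> {x \<in> X. \<nu> x \<noteq> x} - {x \<in> X. \<mu> x \<noteq> x}" using fxd ne by (simp add: \<nu>_def)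
      moreover have "{x \<in> X. \<mu> x \<noteq> x} \<subseteq> {x \<in> X. \<nu> x \<noteq> x}"
        using ne by (auto simp: \<nu>_def)
      ultimately show "{x \<in> X. \<mu> x \<noteq> x} \<subset> {x \<in> X. \<nu> x \<noteq> x}" by blast
    qed (use finite_X in simp)
    ultimately show False by simp
  qed
  have "X \<subseteq> U \<union> (P \<union> \<mu> ` P)"
  proof
    fix x assume "x \<in> X"
    moreover have "x \<in> \<mu> ` P" if "\<mu> x < x"
      by (rule image_eqI[of _ _ "\<mu> x"]) (simp_all add: that mu(2) P_def)
    ultimately show "x \<in> U \<union> (P \<union> \<mu> ` P)" unfolding U_def P_def
      by (cases "\<mu> x" x rule: linorder_cases) (auto simp: P_def)
  qed
  then have "card X \<le> card (U \<union> (P \<union> \<mu> ` P))"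
    using finite_X fP by (intro card_mono) (auto simp: U_def)
  also have "\<dots> \<le> card U + (card P + card P)"
    using card_Un_le[of U "P \<union> \<mu> ` P"] card_Un_le[of P "\<mu> ` P"] card_image_le[OF fP, of \<mu>]
    by linarith
  finally have "card X \<le> card U + 6 * k + 4"
    using unlinked_matching_card_le[OF mu Zk] unfolding P_def by linarith
  moreover have "U \<subseteq> X" unfolding U_def by blast
  moreover have "\<forall>a\<in>U. \<forall>b\<in>U. \<forall>c\<in>U. \<forall>d\<in>U. a \<noteq> b \<longrightarrow> c \<noteq> d \<longrightarrow>
      transpose a b \<circ> transpose c d \<in> A"
  proof (intro ballI impI)
    have cyc: "transpose a b \<circ> transpose b c \<in> A"
      if "a \<in> U" "b \<in> U" "c \<in> U" "a \<noteq> b" "b \<noteq> c" for a b c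
    proof (cases "a = c")
      case True then show ?thesis using id_in_A by (simp add: transpose_commute[of c b])
    next
      case False
      then have "tri a b c" using that linked_tri linkU by simp
      then show ?thesis unfolding tri_def by simp
    qed
    fix a b c d assume U: "a \<in> U" "b \<in> U" "c \<in> U" "d \<in> U" and ne: "a \<noteq> b" "c \<noteq> d"
    show "transpose a b \<circ> transpose c d \<in> A"
    proof (cases "b = c")
      case True then show ?thesis using cyc U ne by simp
    next
      case False
      \<comment> \<open>Inserting \<open>transpose b c\<close> twice splits the product into two
        factors, each a 3-cycle or the identity.\<close>
      have "transpose a b \<circ> transpose c d
          = (transpose a b \<circ> transpose b c) \<circ> (transpose b c \<circ> transpose c d)"
        by (simp add: fun_eq_iff)
      then show ?thesis using A_comp cyc U ne False by simp
    qed
  qed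
  ultimately show ?thesis by (intro exI[of _ U] conjI)
qed

end

section \<open>Evaluation of polynomials\<close>

definition mon_eval :: "(nat \<times> nat \<Rightarrow> 'a::comm_ring_1) \<Rightarrow> ((nat \<times> nat) \<Rightarrow>\<^sub>0 nat) \<Rightarrow> 'a" where
  "mon_eval x m = (\<Prod>k\<in>Poly_Mapping.keys m. x k ^ Poly_Mapping.lookup m k)"

definition poly_eval :: "(nat \<times> nat \<Rightarrow> 'a::comm_ring_1) \<Rightarrow> 'a mpoly \<Rightarrow> 'a" where
  "poly_eval x p = (\<Sum>m\<in>Poly_Mapping.keys p. Poly_Mapping.lookup p m * mon_eval x m)"

text \<open>Absent variables have exponent 0 and contribute the factor 1; this allows a common index
  set for several monomials.\<close>

lemma mon_eval_superset:
  assumes "finite S" "Poly_Mapping.keys m \<subseteq> S"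
  shows "mon_eval x m = (\<Prod>k\<in>S. x k ^ Poly_Mapping.lookup m k)"
  unfolding mon_eval_def
  by (rule prod.mono_neutral_left) (use assms in \<open>auto simp: in_keys_iff\<close>)

lemma mon_eval_add: "mon_eval x (m + m') = mon_eval x m * mon_eval x m'"
proof -
  define S where "S = Poly_Mapping.keys m \<union> Poly_Mapping.keys m'"
  have S: "finite S" "Poly_Mapping.keys m \<subseteq> S" "Poly_Mapping.keys m' \<subseteq> S"
    "Poly_Mapping.keys (m + m') \<subseteq> S"
    unfolding S_def by (simp_all add: keys_add)
  show ?thesis
    unfolding mon_eval_superset[OF S(1,2)] mon_eval_superset[OF S(1,3)]
      mon_eval_superset[OF S(1,4)]
    by (simp add: lookup_add power_add prod.distrib)
qed

lemma poly_eval_single: "poly_eval x (Poly_Mapping.single m c) = c * mon_eval x m"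
  unfolding poly_eval_def by simp

lemma poly_eval_add: "poly_eval x (p + q) = poly_eval x p + poly_eval x q"
  unfolding poly_eval_def by (rule setsum_keys_plus_distrib) (simp_all add: distrib_right)

lemma poly_eval_0: "poly_eval x 0 = 0"
  unfolding poly_eval_def by simp

lemma poly_eval_sum: "poly_eval x (\<Sum>i\<in>I. p i) = (\<Sum>i\<in>I. poly_eval x (p i))"
  by (induction I rule: infinite_finite_induct) (simp_all add: poly_eval_0 poly_eval_add)

text \<open>Reduces multiplicativity of evaluation to single monomials.\<close>

lemma poly_mapping_eq_sum_single:
  "p = (\<Sum>m\<in>Poly_Mapping.keys p. Poly_Mapping.single m (Poly_Mapping.lookup p m))"
  by (rule poly_mapping_eqI) (auto simp: lookup_sum lookup_single when_def in_keys_iff)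

lemma poly_eval_mult: "poly_eval x (p * q) = poly_eval x p * poly_eval x q"
proof -
  have "poly_eval x (p * q) =
      poly_eval x ((\<Sum>m\<in>Poly_Mapping.keys p. Poly_Mapping.single m (Poly_Mapping.lookup p m)) *
        (\<Sum>m\<in>Poly_Mapping.keys q. Poly_Mapping.single m (Poly_Mapping.lookup q m)))"
    by (simp only: poly_mapping_eq_sum_single[symmetric])
  also have "\<dots> = (\<Sum>m\<in>Poly_Mapping.keys p. \<Sum>m'\<in>Poly_Mapping.keys q.
      (Poly_Mapping.lookup p m * mon_eval x m) * (Poly_Mapping.lookup q m' * mon_eval x m'))"
    by (simp add: sum_product poly_eval_sum mult_single poly_eval_single mon_eval_add ac_simps)
  also have "\<dots> = poly_eval x p * poly_eval x q"
    unfolding poly_eval_def by (simp add: sum_product)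
  finally show ?thesis .
qed

lemma poly_eval_pconst: "poly_eval x (pconst c) = c"
  unfolding pconst_def by (simp add: poly_eval_single mon_eval_def)

lemma poly_eval_pvar: "poly_eval x (pvar i j) = x (i, j)"
  unfolding pvar_def by (simp add: poly_eval_single mon_eval_def)

lemma poly_eval_1: "poly_eval x 1 = 1"
  using poly_eval_pconst[of x 1] unfolding pconst_def by simp

lemma poly_eval_prod: "poly_eval x (\<Prod>i\<in>I. p i) = (\<Prod>i\<in>I. poly_eval x (p i))"
  by (induction I rule: infinite_finite_induct) (simp_all add: poly_eval_1 poly_eval_mult)

text \<open>At a permutation matrix only the summand of that permutation survives in the Leibniz
  formula.\<close>

lemma det_poly_eval_permutation_matrix:
  assumes "\<sigma> permutes {1..n}"
  shows "poly_eval (\<lambda>(i, j). if \<sigma> i = j then 1 else 0) (det_poly n) = of_int (sign \<sigma>)"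
proof -
  have "(\<Prod>i\<in>{1..n}. if \<sigma> i = p i then 1 else (0::'a)) = (if p = \<sigma> then 1 else 0)"
    if "p permutes {1..n}" for p
  proof (cases "p = \<sigma>")
    case False
    then obtain i where i: "p i \<noteq> \<sigma> i" by blast
    then have "i \<in> {1..n}" using that assms by (metis permutes_not_in)
    then have "(\<Prod>i\<in>{1..n}. if \<sigma> i = p i then 1 else (0::'a)) = 0"
      using i by (intro prod_zero bexI[of _ i]) auto
    then show ?thesis using False by simp
  qed simp
  then have "poly_eval (\<lambda>(i, j). if \<sigma> i = j then 1 else 0) (det_poly n)
      = (\<Sum>p | p permutes {1..n}. of_int (sign p) * (if p = \<sigma> then 1 else (0::'a)))"
    unfolding det_poly_def poly_eval_sum poly_eval_mult poly_eval_pconst poly_eval_prod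
      poly_eval_pvar
    by (intro sum.cong) auto
  also have "\<dots> = (\<Sum>p | p permutes {1..n}. if p = \<sigma> then of_int (sign p) else 0)"
    by (intro sum.cong) auto
  also have "\<dots> = of_int (sign \<sigma>)"
    using assms by (simp add: finite_permutations)
  finally show ?thesis .
qed

section \<open>Symmetric circuits\<close>

definition row_aut :: "'a circuit \<Rightarrow> (nat \<Rightarrow> nat) \<Rightarrow> (nat \<Rightarrow> nat) \<Rightarrow> bool" where
  "row_aut C \<sigma> f \<longleftrightarrow> bij_betw f (gates C) (gates C) \<and>
     (\<forall>a\<in>gates C. \<forall>b\<in>gates C. (a, b) \<in> wires C \<longleftrightarrow> (f a, f b) \<in> wires C) \<and>
     (\<forall>a\<in>gates C. label C (f a) = act_label (\<sigma>, id) (label C a))"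

text \<open>Several automorphisms may extend the same \<open>\<sigma>\<close>, so
  \<open>\<sigma>\<close> itself need not act on the gates; the existential still yields a
  subgroup.\<close>

definition gate_stab :: "nat \<Rightarrow> 'a circuit \<Rightarrow> nat \<Rightarrow> (nat \<Rightarrow> nat) set" where
  "gate_stab n C a = {\<sigma> \<in> alt_group n. \<exists>f. row_aut C \<sigma> f \<and> f a = a}"

lemma row_aut_in_gates: "row_aut C \<sigma> f \<Longrightarrow> a \<in> gates C \<Longrightarrow> f a \<in> gates C"
  unfolding row_aut_def by (blast dest: bij_betwE)

lemma row_aut_comp:
  assumes "row_aut C \<sigma> f" "row_aut C \<tau> g" shows "row_aut C (\<sigma> \<circ> \<tau>) (f \<circ> g)"
proof -
  have "act_label (\<sigma> \<circ> \<tau>, id) l = act_label (\<sigma>, id) (act_label (\<tau>, id) l)" for l :: "'a gate_label"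
    by (cases l) simp_all
  moreover have "(a, b) \<in> wires C \<longleftrightarrow> (f (g a), f (g b)) \<in> wires C"
    if "a \<in> gates C" "b \<in> gates C" for a b
    using assms row_aut_in_gates[OF assms(2)] that unfolding row_aut_def by blast
  moreover have "label C (f (g a)) = act_label (\<sigma>, id) (act_label (\<tau>, id) (label C a))"
    if "a \<in> gates C" for a
    using assms row_aut_in_gates[OF assms(2) that] that unfolding row_aut_def by simp
  moreover have "bij_betw (f \<circ> g) (gates C) (gates C)"
    using assms bij_betw_trans unfolding row_aut_def by blast
  ultimately show ?thesis unfolding row_aut_def by simp
qed

lemma row_aut_inv:
  assumes f: "row_aut C \<sigma> f" and s: "bij \<sigma>"
  shows "row_aut C (inv \<sigma>) (inv_into (gates C) f)"
proof -
  let ?h = "inv_into (gates C) f"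
  have bij: "bij_betw f (gates C) (gates C)" using f row_aut_def by blast
  have h: "?h a \<in> gates C" "f (?h a) = a" if "a \<in> gates C" for a
    using that bij by (auto simp: bij_betw_def inv_into_into f_inv_into_f)
  have act: "act_label (inv \<sigma>, id) (act_label (\<sigma>, id) l) = l" for l :: "'a gate_label"
    using s by (cases l) (simp_all add: bij_is_inj)
  have "label C (?h a) = act_label (inv \<sigma>, id) (label C a)" if "a \<in> gates C" for a
    using f h[OF that] act unfolding row_aut_def by metis
  moreover have "(a, b) \<in> wires C \<longleftrightarrow> (?h a, ?h b) \<in> wires C" if "a \<in> gates C" "b \<in> gates C" for a b
    using f h[OF that(1)] h[OF that(2)] unfolding row_aut_def by metis
  ultimately show ?thesis using bij_betw_inv_into[OF bij] unfolding row_aut_def by blast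
qed

lemma alt_group_comp: "\<sigma> \<in> alt_group n \<Longrightarrow> \<tau> \<in> alt_group n \<Longrightarrow> \<sigma> \<circ> \<tau> \<in> alt_group n"
  unfolding alt_group_def
  by (metis (mono_tags, lifting) evenperm_comp finite_atLeastAtMost mem_Collect_eq
      permutation_permutes permutes_compose)

lemma alt_group_inv: "\<sigma> \<in> alt_group n \<Longrightarrow> inv \<sigma> \<in> alt_group n"
  unfolding alt_group_def
  by (metis (mono_tags, lifting) evenperm_inv finite_atLeastAtMost mem_Collect_eq
      permutation_permutes permutes_inv)

text \<open>The inverse of \<open>f\<close> composed with \<open>g\<close> extends
  \<open>inv \<sigma> \<circ> \<tau>\<close> and fixes \<open>a\<close>. Hence the image of
  \<open>a\<close> determines the coset.\<close>

lemma gate_stab_quotient: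
  assumes "\<sigma> \<in> alt_group n" "\<tau> \<in> alt_group n" "row_aut C \<sigma> f" "row_aut C \<tau> g"
    "f a = g a" "a \<in> gates C"
  shows "inv \<sigma> \<circ> \<tau> \<in> gate_stab n C a"
proof -
  have "bij \<sigma>" using assms(1) permutes_bij unfolding alt_group_def by blast
  then have "row_aut C (inv \<sigma> \<circ> \<tau>) (inv_into (gates C) f \<circ> g)"
    using row_aut_comp row_aut_inv assms by blast
  moreover have "(inv_into (gates C) f \<circ> g) a = a"
    using assms(3,5,6) unfolding row_aut_def bij_betw_def by (metis comp_apply inv_into_f_f)
  ultimately show ?thesis
    using alt_group_comp alt_group_inv assms unfolding gate_stab_def by blast
qed

lemma gate_stab_large:
  assumes fin: "finite (gates C)" and aut: "\<And>\<sigma>. \<sigma> \<in> alt_group n \<Longrightarrow> \<exists>f. row_aut C \<sigma> f"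
    and a: "a \<in> gates C" and size: "2 * card (gates C) \<le> 2 ^ k" and n: "2 \<le> n"
  shows "\<exists>U\<subseteq>{1..n}. n \<le> card U + 6 * k + 4 \<and>
    (\<forall>i\<in>U. \<forall>j\<in>U. \<forall>k\<in>U. \<forall>l\<in>U. i \<noteq> j \<longrightarrow> k \<noteq> l \<longrightarrow>
      transpose i j \<circ> transpose k l \<in> gate_stab n C a)"
proof -
  obtain F where F: "\<And>\<sigma>. \<sigma> \<in> alt_group n \<Longrightarrow> row_aut C \<sigma> (F \<sigma>)" using aut by metis
  define t :: "nat \<Rightarrow> nat" where "t = transpose 1 2"
  \<comment> \<open>Automorphisms are given for even permutations only, whereas codes must cover all
    of them. Odd ones are made even by \<open>t\<close> and told apart by a parity bit, which
    doubles the number of codes; \<open>t\<close> cancels in quotients of equal parity.\<close>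
  define e where "e \<sigma> = (if evenperm \<sigma> then \<sigma> else t \<circ> \<sigma>)" for \<sigma>
  define code where "code \<sigma> = (evenperm \<sigma>, F (e \<sigma>) a)" for \<sigma>
  have t: "t permutes {1..n}" unfolding t_def using n by (intro permutes_swap_id) auto
  have perm: "permutation \<sigma>" if "\<sigma> permutes {1..n}" for \<sigma>
    using that permutation_permutes by blast
  have e_alt: "e \<sigma> \<in> alt_group n" if "\<sigma> permutes {1..n}" for \<sigma>
    unfolding e_def alt_group_def
    using that t perm by (auto simp: permutes_compose evenperm_comp) (simp add: t_def evenperm_swap)
  have e_quot: "inv (e \<sigma>) \<circ> e \<tau> = inv \<sigma> \<circ> \<tau>"
    if "\<sigma> permutes {1..n}" "\<tau> permutes {1..n}" "evenperm \<sigma> = evenperm \<tau>" for \<sigma> \<tau>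
  proof (cases "evenperm \<sigma>")
    case False
    have "inv (t \<circ> \<sigma>) = inv \<sigma> \<circ> t"
      using permutes_bij[OF that(1)] permutes_bij[OF t] by (simp add: o_inv_distrib t_def)
    moreover have "t \<circ> (t \<circ> \<tau>) = \<tau>" by (simp add: fun_eq_iff t_def)
    ultimately show ?thesis using False that(3) by (simp add: e_def comp_assoc)
  qed (use that in \<open>simp add: e_def\<close>)
  interpret coded_subgroup "{1..n}" "gate_stab n C a" code "UNIV \<times> gates C"
  proof
    fix g h
    show "finite {1..n}" "finite (UNIV \<times> gates C :: (bool \<times> nat) set)" using fin by simp_all
    show "g permutes {1..n}" if "g \<in> gate_stab n C a"
      using that unfolding gate_stab_def alt_group_def by simp
    show "g \<circ> h \<in> gate_stab n C a" if gh: "g \<in> gate_stab n C a" "h \<in> gate_stab n C a"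
    proof -
      obtain f f' where "row_aut C g f" "f a = a" "row_aut C h f'" "f' a = a"
        using gh unfolding gate_stab_def by blast
      then have "row_aut C (g \<circ> h) (f \<circ> f')" "(f \<circ> f') a = a" using row_aut_comp by auto
      then show ?thesis using gh alt_group_comp unfolding gate_stab_def by blast
    qed
    show "inv g \<in> gate_stab n C a" if g: "g \<in> gate_stab n C a"
    proof -
      have "id \<in> alt_group n" unfolding alt_group_def by (simp add: permutes_id)
      moreover have "row_aut C id id"
        unfolding row_aut_def
      proof (intro conjI ballI)
        show "label C (id b) = act_label (id, id) (label C b)" for b
          by (cases "label C b") simp_all
      qed simp_all
      ultimately have "inv g \<circ> id \<in> gate_stab n C a"
        using gate_stab_quotient[of g n id C _ id a] g a unfolding gate_stab_def by auto
      then show ?thesis by simp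
    qed
    show "code g \<in> UNIV \<times> gates C" if "g permutes {1..n}"
      unfolding code_def using row_aut_in_gates[OF F[OF e_alt[OF that]] a] by simp
    show "inv g \<circ> h \<in> gate_stab n C a"
      if gh: "g permutes {1..n}" "h permutes {1..n}" "code g = code h"
    proof -
      have "inv (e g) \<circ> e h \<in> gate_stab n C a"
        using gate_stab_quotient[OF e_alt[OF gh(1)] e_alt[OF gh(2)] F[OF e_alt[OF gh(1)]]
            F[OF e_alt[OF gh(2)]] _ a] gh(3) unfolding code_def by simp
      then show ?thesis using e_quot gh unfolding code_def by simp
    qed
  qed
  have "card (UNIV \<times> gates C :: (bool \<times> nat) set) \<le> 2 ^ k"
    using size by (simp add: card_cartesian_product)
  then show ?thesis using large_alternating_part[of k] by simp
qed

section \<open>Gates as functions of the matrix\<close>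

definition row_act :: "(nat \<Rightarrow> nat) \<Rightarrow> (nat \<times> nat \<Rightarrow> 'a) \<Rightarrow> nat \<times> nat \<Rightarrow> 'a" where
  "row_act \<sigma> x = (\<lambda>(i, j). x (\<sigma> i, j))"

lemma row_act_comp: "row_act (\<sigma> \<circ> \<tau>) x = row_act \<tau> (row_act \<sigma> x)"
  unfolding row_act_def by auto

lemma row_act_transpose_twice [simp]: "row_act (transpose i j) (row_act (transpose i j) x) = x"
  unfolding row_act_def by auto

text \<open>With functions instead of formal polynomials, renaming variables becomes a change of the
  argument.\<close>

definition gate_function :: "'a::comm_ring_1 circuit \<Rightarrow> (nat \<Rightarrow> (nat \<times> nat \<Rightarrow> 'a) \<Rightarrow> 'a) \<Rightarrow> bool" where
  "gate_function C w \<longleftrightarrow> (\<forall>g\<in>gates C. \<forall>x. w g x = (case label C g of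
      Var i j \<Rightarrow> x (i, j)
    | Const c \<Rightarrow> c
    | Plus \<Rightarrow> (\<Sum>h\<in>children C g. w h x)
    | Times \<Rightarrow> (\<Prod>h\<in>children C g. w h x)))"

lemma circuit_valuation_gate_function:
  "circuit_valuation C v \<Longrightarrow> gate_function C (\<lambda>g x. poly_eval x (v g))"
  unfolding circuit_valuation_def gate_function_def
  by (auto simp: poly_eval_pvar poly_eval_pconst poly_eval_sum poly_eval_prod
      split: gate_label.split)

lemma children_subset: "wf_circuit n C \<Longrightarrow> children C g \<subseteq> gates C"
  unfolding wf_circuit_def children_def by blast

lemma row_aut_children:
  assumes "wf_circuit n C" "row_aut C \<sigma> f" "a \<in> gates C"
  shows "children C (f a) = f ` children C a"
proof -
  have W: "wires C \<subseteq> gates C \<times> gates C" using assms(1) unfolding wf_circuit_def by blast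
  have "b \<in> f ` children C a" if "(b, f a) \<in> wires C" for b
  proof -
    have "b \<in> gates C" using that W by blast
    then obtain c where "c \<in> gates C" "b = f c"
      using assms(2) unfolding row_aut_def bij_betw_def by blast
    then show ?thesis using that assms(2,3) unfolding row_aut_def children_def by blast
  qed
  moreover have "(f b, f a) \<in> wires C" if "(b, a) \<in> wires C" for b
    using that W assms(2,3) unfolding row_aut_def by blast
  ultimately show ?thesis unfolding children_def by blast
qed

text \<open>Induction along the wires: \<open>f\<close> maps the children of \<open>a\<close>
  bijectively to those of \<open>f a\<close>, so sums and products can be reindexed.\<close>

lemma gate_function_equivariant:
  assumes C: "wf_circuit n C" and w: "gate_function C w" and f: "row_aut C \<sigma> f"
  shows "a \<in> gates C \<Longrightarrow> w (f a) x = w a (row_act \<sigma> x)"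
proof -
  have "wf (wires C)" using C unfolding wf_circuit_def by blast
  then show "a \<in> gates C \<Longrightarrow> w (f a) x = w a (row_act \<sigma> x)"
  proof (induction a rule: wf_induct_rule)
    case (less a)
    have IH: "w (f b) x = w b (row_act \<sigma> x)" if "b \<in> children C a" for b
      using less.IH[of b] that children_subset[OF C] unfolding children_def by blast
    have inj: "inj_on f (children C a)"
      using f children_subset[OF C] unfolding row_aut_def bij_betw_def
      by (meson inj_on_subset)
    have l: "label C (f a) = act_label (\<sigma>, id) (label C a)"
      using f less.prems unfolding row_aut_def by blast
    have "w (f a) x = (case label C (f a) of Var i j \<Rightarrow> x (i, j) | Const c \<Rightarrow> c
        | Plus \<Rightarrow> (\<Sum>h\<in>children C (f a). w h x) | Times \<Rightarrow> (\<Prod>h\<in>children C (f a). w h x))"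
      using w row_aut_in_gates[OF f less.prems] unfolding gate_function_def by blast
    moreover have "w a (row_act \<sigma> x) = (case label C a of Var i j \<Rightarrow> row_act \<sigma> x (i, j) | Const c \<Rightarrow> c
        | Plus \<Rightarrow> (\<Sum>h\<in>children C a. w h (row_act \<sigma> x))
        | Times \<Rightarrow> (\<Prod>h\<in>children C a. w h (row_act \<sigma> x)))"
      using w less.prems unfolding gate_function_def by blast
    ultimately show ?case
      unfolding l row_aut_children[OF C f less.prems]
      by (cases "label C a") (simp_all add: row_act_def sum.reindex[OF inj] prod.reindex[OF inj] IH)
  qed
qed

text \<open>The inequality at \<open>T \<phi>\<close> is the converse of the one at
  \<open>\<phi>\<close>. Multisets are used because different children may compute the same
  function.\<close>

lemma image_mset_involution_invariant:
  fixes w :: "'a \<Rightarrow> 'b"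
  assumes fin: "finite B" and inv: "\<And>\<phi>. T (T \<phi>) = \<phi>"
    and le: "\<And>\<phi>. card {b \<in> B. w b = \<phi>} \<le> card {b \<in> B. w b = T \<phi>}"
  shows "image_mset (\<lambda>b. T (w b)) (mset_set B) = image_mset w (mset_set B)"
proof (rule multiset_eqI)
  fix \<phi>
  have count: "count (image_mset u (mset_set B)) \<phi> = card {b \<in> B. u b = \<phi>}" for u :: "'a \<Rightarrow> 'b"
    using fin by (simp add: count_image_mset' Collect_conj_eq Int_commute vimage_def eq_commute)
  have "{b \<in> B. T (w b) = \<phi>} = {b \<in> B. w b = T \<phi>}" using inv by metis
  moreover have "card {b \<in> B. w b = \<phi>} = card {b \<in> B. w b = T \<phi>}"
    using le[of \<phi>] le[of "T \<phi>"] inv[of \<phi>] by simp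
  ultimately show "count (image_mset (\<lambda>b. T (w b)) (mset_set B)) \<phi> = count (image_mset w (mset_set B)) \<phi>"
    unfolding count by simp
qed

text \<open>Every child \<open>b\<close> of \<open>a\<close> is fixed by some transposition \<open>(k l)\<close> on \<open>U a \<inter> U b\<close>, so
  \<open>(i j)\<close> acts on it like the even permutation \<open>(i j)(k l)\<close>, which comes from an automorphism
  of the circuit fixing \<open>a\<close>.\<close>

lemma gate_function_transpose_invariant:
  assumes C: "wf_circuit n C" and w: "gate_function C w" and n: "4 \<le> n"
    and U: "\<And>a. a \<in> gates C \<Longrightarrow> U a \<subseteq> {1..n}"
    and large: "\<And>a. a \<in> gates C \<Longrightarrow> n + 2 \<le> 2 * card (U a)"
    and stab: "\<And>a i j k l. a \<in> gates C \<Longrightarrow> i \<in> U a \<Longrightarrow> j \<in> U a \<Longrightarrow> k \<in> U a \<Longrightarrow> l \<in> U a \<Longrightarrow>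
      i \<noteq> j \<Longrightarrow> k \<noteq> l \<Longrightarrow> transpose i j \<circ> transpose k l \<in> gate_stab n C a"
  shows "a \<in> gates C \<Longrightarrow> i \<in> U a \<Longrightarrow> j \<in> U a \<Longrightarrow> i \<noteq> j \<Longrightarrow> w a (row_act (transpose i j) x) = w a x"
proof -
  have wfW: "wf (wires C)" and fin: "finite (gates C)" using C unfolding wf_circuit_def by blast+
  from wfW
  show "a \<in> gates C \<Longrightarrow> i \<in> U a \<Longrightarrow> j \<in> U a \<Longrightarrow> i \<noteq> j \<Longrightarrow> w a (row_act (transpose i j) x) = w a x"
  proof (induction a arbitrary: i j x rule: wf_induct_rule)
    case (less a)
    note a = less.prems(1) and ij = less.prems(2-4)
    define B where "B = children C a"
    have B: "B \<subseteq> gates C" using children_subset[OF C] B_def by blast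
    have finB: "finite B" using B fin finite_subset by blast
    have IH: "w b (row_act (transpose k l) y) = w b y"
      if "b \<in> B" "k \<in> U b" "l \<in> U b" "k \<noteq> l" for b k l y
      using less.IH[of b] that B unfolding B_def children_def by blast
    define T where "T \<phi> = (\<lambda>y. \<phi> (row_act (transpose i j) y))" for \<phi> :: "(nat \<times> nat \<Rightarrow> 'a) \<Rightarrow> 'a"
    have "card {b \<in> B. w b = \<phi>} \<le> card {b \<in> B. w b = T \<phi>}" for \<phi>
    proof (cases "{b \<in> B. w b = \<phi>} = {}")
      case True
      then show ?thesis by (metis card.empty le0)
    next
      case False
      then obtain b where b: "b \<in> B" "w b = \<phi>" by blast
      have fU: "finite (U a)" "finite (U b)" using U a b B finite_subset by blast+
      have "card (U a \<union> U b) \<le> card {1..n}" using U a b B by (intro card_mono) auto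
      \<comment> \<open>Both sets lie in \<open>{1..n}\<close> and their sizes add up to at least
        \<open>n + 2\<close>.\<close>
      then have "2 \<le> card (U a \<inter> U b)"
        using card_Un_Int[OF fU] large[OF a] large[of b] b B by auto
      then obtain D where "D \<subseteq> U a \<inter> U b" "card D = 2" using obtain_subset_with_card_n by metis
      then obtain k l where kl: "k \<in> U a" "l \<in> U a" "k \<in> U b" "l \<in> U b" "k \<noteq> l"
        by (auto simp: card_2_iff)
      obtain f where f: "row_aut C (transpose i j \<circ> transpose k l) f" "f a = a"
        using stab[OF a ij(1,2) kl(1,2) ij(3) kl(5)] unfolding gate_stab_def by blast
      have "f ` {b \<in> B. w b = \<phi>} \<subseteq> {b \<in> B. w b = T \<phi>}"
      proof clarify
        fix c assume c: "c \<in> B" "\<phi> = w c"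
        have "w (f c) y = T (w c) y" for y
        proof -
          have "w (f c) y = w c (row_act (transpose k l) (row_act (transpose i j) y))"
            using gate_function_equivariant[OF C w f(1)] c B row_act_comp by (metis subsetD)
          also have "\<dots> = w b (row_act (transpose k l) (row_act (transpose i j) y))"
            using b c by simp
          also have "\<dots> = w b (row_act (transpose i j) y)" using IH b kl by blast
          finally show ?thesis using b c unfolding T_def by simp
        qed
        moreover have "f c \<in> B"
          using row_aut_children[OF C f(1) a] f(2) c unfolding B_def by auto
        ultimately show "f c \<in> B \<and> w (f c) = T (w c)" by blast
      qed
      moreover have "inj_on f {b \<in> B. w b = \<phi>}"
        using f(1) B unfolding row_aut_def bij_betw_def by (auto intro: inj_on_subset)
      ultimately show ?thesis using finB by (intro card_inj_on_le) auto
    qed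
    then have inv: "image_mset (\<lambda>b. T (w b)) (mset_set B) = image_mset w (mset_set B)"
      using finB by (intro image_mset_involution_invariant) (auto simp: T_def)
    then have "image_mset (\<lambda>\<phi>. \<phi> x) (image_mset (\<lambda>b. T (w b)) (mset_set B))
        = image_mset (\<lambda>\<phi>. \<phi> x) (image_mset w (mset_set B))" by simp
    then have inv: "image_mset (\<lambda>b. w b (row_act (transpose i j) x)) (mset_set B)
        = image_mset (\<lambda>b. w b x) (mset_set B)"
      by (simp add: T_def image_mset.compositionality comp_def)
    have sums: "(\<Sum>b\<in>B. w b (row_act (transpose i j) x)) = (\<Sum>b\<in>B. w b x)"
      "(\<Prod>b\<in>B. w b (row_act (transpose i j) x)) = (\<Prod>b\<in>B. w b x)"
      using inv by (simp_all add: sum_unfold_sum_mset prod_unfold_prod_mset)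
    have leaf: "transpose i j r = r" if lab: "label C a = Var r s" for r s
    proof (rule ccontr)
      assume "transpose i j r \<noteq> r"
      then have r: "r = i \<or> r = j" by (metis transpose_apply_other)
      \<comment> \<open>From \<open>4 \<le> n\<close> the set \<open>U a\<close> has at least three
        points. With a third point \<open>k\<close>, the 3-cycle on \<open>i\<close>,
        \<open>j\<close>, \<open>k\<close> comes from an automorphism fixing \<open>a\<close>, yet
        it would change the row in its label.\<close>
      have "\<not> U a \<subseteq> {i, j}"
      proof
        assume "U a \<subseteq> {i, j}"
        then have "card (U a) \<le> card {i, j}" by (intro card_mono) auto
        then show False using large[OF a] n ij by simp
      qed
      then obtain k where k: "k \<in> U a" "k \<noteq> i" "k \<noteq> j" by blast
      obtain f where f: "row_aut C (transpose i j \<circ> transpose j k) f" "f a = a"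
        using stab[OF a ij(1,2) ij(2) k(1) ij(3)] k unfolding gate_stab_def by blast
      then have "act_label (transpose i j \<circ> transpose j k, id) (Var r s) = (Var r s :: 'a gate_label)"
        using a lab unfolding row_aut_def by metis
      then show False using r k ij by (auto simp: transpose_def split: if_splits)
    qed
    show ?case
      using w a sums leaf unfolding gate_function_def B_def
      by (cases "label C a") (auto simp: row_act_def)
  qed
qed

section \<open>The lower bound for circuits computing the determinant\<close>

lemma symmetric_circuit_det_size:
  fixes C :: "'a::field_char_0 circuit"
  assumes C: "wf_circuit n C" and sym: "symmetric_circuit (alt_alt n) C"
    and comp: "computes C (det_poly n)" and n: "12 * k + 10 \<le> n"
  shows "2 ^ k < 2 * circuit_size C"
proof (rule ccontr)
  assume "\<not> 2 ^ k < 2 * circuit_size C"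
  then have size: "2 * card (gates C) \<le> 2 ^ k" unfolding circuit_size_def by simp
  have fin: "finite (gates C)" and out: "out_gate C \<in> gates C" using C unfolding wf_circuit_def by blast+
  have aut: "\<exists>f. row_aut C \<sigma> f" if "\<sigma> \<in> alt_group n" for \<sigma>
  proof -
    have "(\<sigma>, id) \<in> alt_alt n"
      using that unfolding alt_alt_def alt_group_def by (simp add: permutes_id)
    then show ?thesis using sym unfolding symmetric_circuit_def row_aut_def by blast
  qed
  have "\<forall>a\<in>gates C. \<exists>U\<subseteq>{1..n}. n \<le> card U + 6 * k + 4 \<and>
    (\<forall>i\<in>U. \<forall>j\<in>U. \<forall>k\<in>U. \<forall>l\<in>U. i \<noteq> j \<longrightarrow> k \<noteq> l \<longrightarrow>
      transpose i j \<circ> transpose k l \<in> gate_stab n C a)"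
    using gate_stab_large[OF fin aut _ size] n by simp
  then obtain U where U: "\<And>a. a \<in> gates C \<Longrightarrow> U a \<subseteq> {1..n}"
    and large: "\<And>a. a \<in> gates C \<Longrightarrow> n \<le> card (U a) + 6 * k + 4"
    and stab: "\<And>a i j k l. a \<in> gates C \<Longrightarrow> i \<in> U a \<Longrightarrow> j \<in> U a \<Longrightarrow> k \<in> U a \<Longrightarrow> l \<in> U a \<Longrightarrow>
      i \<noteq> j \<Longrightarrow> k \<noteq> l \<Longrightarrow> transpose i j \<circ> transpose k l \<in> gate_stab n C a"
    by metis
  \<comment> \<open>This is where \<open>12 * k + 10 \<le> n\<close> comes from: twice
    \<open>n - 6 * k - 4\<close> must reach \<open>n + 2\<close>.\<close>
  have large': "n + 2 \<le> 2 * card (U a)" if "a \<in> gates C" for a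
    using large[OF that] n by simp
  obtain v where v: "circuit_valuation C v" "v (out_gate C) = det_poly n"
    using comp computes_def by blast
  have "2 \<le> card (U (out_gate C))" using large'[OF out] n by simp
  then obtain D where "D \<subseteq> U (out_gate C)" "card D = 2" using obtain_subset_with_card_n by metis
  then obtain i j where ij: "i \<in> U (out_gate C)" "j \<in> U (out_gate C)" "i \<noteq> j"
    by (auto simp: card_2_iff)
  \<comment> \<open>The identity matrix; swapping two of its rows turns the determinant from 1 into
    -1, and these differ in characteristic 0.\<close>
  define x :: "nat \<times> nat \<Rightarrow> 'a" where "x = (\<lambda>(i, j). if id i = j then 1 else 0)"
  have "poly_eval (row_act (transpose i j) x) (det_poly n) = poly_eval x (det_poly n)"
    using gate_function_transpose_invariant[where U = U,
        OF C circuit_valuation_gate_function[OF v(1)] _ U large' stab out ij] n v(2) by simp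
  moreover have "poly_eval (row_act (transpose i j) x) (det_poly n) = - 1"
  proof -
    have "row_act (transpose i j) x = (\<lambda>(r, s). if transpose i j r = s then 1 else 0)"
      unfolding row_act_def x_def by auto
    moreover have "transpose i j permutes {1..n}"
      using ij U[OF out] by (intro permutes_swap_id) auto
    ultimately show ?thesis
      using det_poly_eval_permutation_matrix[of "transpose i j" n, where 'a = 'a] ij
      by (simp add: sign_swap_id)
  qed
  moreover have "poly_eval x (det_poly n) = 1"
    using det_poly_eval_permutation_matrix[OF permutes_id, of n, where 'a = 'a]
    unfolding x_def by simp
  ultimately have "(- 1 :: 'a) = 1" by simp
  then show False by simp
qed

theorem mainTheorem1:
  fixes C :: "nat \<Rightarrow> 'a::field_char_0 circuit"
  shows "\<not> ((\<forall>n. wf_circuit n (C n) \<and> symmetric_circuit (alt_alt n) (C n)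
                 \<and> computes (C n) (det_poly n))
           \<and> (\<exists>s::nat \<Rightarrow> real. s \<in> o(\<lambda>n. real n) \<and>
                (\<forall>n. real (circuit_size (C n)) \<le> 2 powr s n)))"
proof
  assume asm: "(\<forall>n. wf_circuit n (C n) \<and> symmetric_circuit (alt_alt n) (C n)
                 \<and> computes (C n) (det_poly n))
           \<and> (\<exists>s::nat \<Rightarrow> real. s \<in> o(\<lambda>n. real n) \<and>
                (\<forall>n. real (circuit_size (C n)) \<le> 2 powr s n))"
  then obtain s :: "nat \<Rightarrow> real" where s: "s \<in> o(\<lambda>n. real n)"
    and size: "\<And>n. real (circuit_size (C n)) \<le> 2 powr s n" by blast
  \<comment> \<open>Any constant below 1/12 would do, as \<open>12 * k + 10 \<le> n\<close> must
    hold with \<open>k\<close> slightly above \<open>s n\<close>; 1/24 leaves room for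
    rounding.\<close>
  have "\<forall>\<^sub>F n in sequentially. norm (s n) \<le> 1 / 24 * norm (real n)"
    using s by (rule landau_o.smallD) simp
  then obtain n where n: "68 \<le> n" "norm (s n) \<le> 1 / 24 * norm (real n)"
    unfolding eventually_sequentially by (metis linorder_linear)
  \<comment> \<open>One unit of the \<open>+ 2\<close> pays for rounding down, the other for the
    factor 2 in front of the size.\<close>
  define k where "k = n div 24 + 2"
  have "real n \<le> 24 * real (n div 24) + 24" by linarith
  then have "s n + 1 \<le> real k" using n unfolding k_def by auto
  then have "2 powr (s n + 1) \<le> 2 powr real k" by simp
  then have "2 * real (circuit_size (C n)) \<le> 2 ^ k"
    using size[of n] by (simp add: powr_add powr_realpow)
  then have "2 * circuit_size (C n) \<le> 2 ^ k"
    by (metis of_nat_le_iff of_nat_mult of_nat_numeral of_nat_power)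
  moreover have "12 * k + 10 \<le> n" using n(1) unfolding k_def by presburger
  ultimately show False
    using symmetric_circuit_det_size[of n "C n" k] asm by (meson leD)
qed

end
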